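(* If $\mathcal{C}$ is a $d$-uniform W-chordal clutter, then $\mathcal{C}\in\mathfrak{C}_d$, i.e. $\mathcal{C}$ is a chordal clutter.
   Context: A clutter $\mathcal{C}$ with (finite) vertex set $V(\mathcal{C})$ is a collection of subsets of $V(\mathcal{C})$, called circuits, none of which is contained in another; vertices need not lie in a circuit. It is $d$-uniform if every circuit has exactly $d$ elements. Chordal: let $\mathcal{C}$ be $d$-uniform. A $(d-1)$-subset $e$ of the vertex set is a submaximal circuit of $\mathcal{C}$ if $e\subset F$ for some $F\in\mathcal{C}$. A set $V$ of vertices is a clique in $\mathcal{C}$ if all $d$-subsets of $V$ belong to $\mathcal{C}$ (sets with fewer than $d$ elements are cliques). $N_{\mathcal{C}}[e]=e\cup\{c: e\cup\{c\}\in\mathcal{C}\}$, and $e$ is simplicial in $\mathcal{C}$ if $N_{\mathcal{C}}[e]$ is a clique. The deletion is $\mathcal{C}\setminus e=\{F\in\mathcal{C}: e\nsubseteq F\}$ (same vertex set). $\mathcal{C}$ is chordal if either $\mathcal{C}=\varnothing$ or (recursively) $\mathcal{C}$ admits a simplicial submaximal circuit $e$ such that $\mathcal{C}\setminus e$ is chordal. $\mathfrak{C}_d$ denotes the class of $d$-uniform chordal clutters. W-chordal: for a (not necessarily uniform) clutter $\mathcal{C}$ and $v\in V(\mathcal{C})$, the deletion $\mathcal{C}\setminus v$ is the clutter on $V(\mathcal{C})\setminus\{v\}$ with circuits $\{F\in\mathcal{C}: v\notin F\}$; the contraction $\mathcal{C}/v$ is the clutter on $V(\mathcal{C})\setminus\{v\}$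 whose circuits are the inclusion-minimal sets of $\{F\setminus\{v\}: F\in\mathcal{C}\}$. A minor of $\mathcal{C}$ is a clutter obtained from $\mathcal{C}$ by a (possibly empty) sequence of vertex deletions and/or contractions. A vertex $v$ is W-simplicial in $\mathcal{C}$ if for every two distinct circuits $F_1,F_2$ containing $v$ there is a circuit $F_3\subseteq(F_1\cup F_2)\setminus\{v\}$. $\mathcal{C}$ is W-chordal if every minor of $\mathcal{C}$ with nonempty vertex set has a W-simplicial vertex. *)

theory Defs
  imports Main
begin

text \<open>
  A clutter is given by its vertex set \<open>V\<close> and its set of circuits \<open>C\<close>, since
  vertices need not lie in a circuit.
\<close>

definition clutter :: "'a set \<Rightarrow> 'a set set \<Rightarrow> bool" where
  "clutter V C \<longleftrightarrow> finite V \<and> (\<forall>F\<in>C. F \<subseteq> V) \<and> (\<forall>F\<in>C. \<forall>G\<in>C. F \<subseteq> G \<longrightarrow> F = G)"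

definition uniform_clutter :: "nat \<Rightarrow> 'a set \<Rightarrow> 'a set set \<Rightarrow> bool" where
  "uniform_clutter d V C \<longleftrightarrow> clutter V C \<and> (\<forall>F\<in>C. card F = d)"

text \<open>The condition \<^term>\<open>card e + 1 = d\<close> avoids truncated subtraction at \<open>d = 0\<close>.\<close>

definition submaximal_circuit :: "nat \<Rightarrow> 'a set \<Rightarrow> 'a set set \<Rightarrow> 'a set \<Rightarrow> bool" where
  "submaximal_circuit d V C e \<longleftrightarrow> e \<subseteq> V \<and> card e + 1 = d \<and> (\<exists>F\<in>C. e \<subset> F)"

definition clique :: "nat \<Rightarrow> 'a set \<Rightarrow> 'a set set \<Rightarrow> 'a set \<Rightarrow> bool" where
  "clique d V C A \<longleftrightarrow> A \<subseteq> V \<and> (\<forall>S. S \<subseteq> A \<and> card S = d \<longrightarrow> S \<in> C)"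

definition closed_nbhd :: "'a set set \<Rightarrow> 'a set \<Rightarrow> 'a set" where
  "closed_nbhd C e = e \<union> {c. e \<union> {c} \<in> C}"

definition simplicial :: "nat \<Rightarrow> 'a set \<Rightarrow> 'a set set \<Rightarrow> 'a set \<Rightarrow> bool" where
  "simplicial d V C e \<longleftrightarrow> clique d V C (closed_nbhd C e)"

definition set_deletion :: "'a set set \<Rightarrow> 'a set \<Rightarrow> 'a set set" where
  "set_deletion C e = {F \<in> C. \<not> e \<subseteq> F}"

text \<open>The recursive condition only; uniformity is added in \<open>chordal_clutter\<close> below.\<close>

inductive chordal :: "nat \<Rightarrow> 'a set \<Rightarrow> 'a set set \<Rightarrow> bool" for d V where
  empty: "chordal d V {}"
| step: "chordal d V C"
    if "submaximal_circuit d V C e" "simplicial d V C e" "chordal d V (set_deletion C e)"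

text \<open>Membership in the class \<open>C_d\<close> of \<open>d\<close>-uniform chordal clutters.\<close>

definition chordal_clutter :: "nat \<Rightarrow> 'a set \<Rightarrow> 'a set set \<Rightarrow> bool" where
  "chordal_clutter d V C \<longleftrightarrow> uniform_clutter d V C \<and> chordal d V C"

text \<open>
  Circuits of the vertex deletion and of the contraction; both live on the vertex set
  \<^term>\<open>V - {v}\<close>.
\<close>

definition vertex_deletion :: "'a set set \<Rightarrow> 'a \<Rightarrow> 'a set set" where
  "vertex_deletion C v = {F \<in> C. v \<notin> F}"

definition minimal_sets :: "'a set set \<Rightarrow> 'a set set" where
  "minimal_sets \<S> = {S \<in> \<S>. \<not> (\<exists>T\<in>\<S>. T \<subset> S)}"

definition contraction :: "'a set set \<Rightarrow> 'a \<Rightarrow> 'a set set" where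
  "contraction C v = minimal_sets {F - {v} |F. F \<in> C}"

text \<open>\<open>minor V C V' C'\<close>: the clutter \<open>(V', C')\<close> is a minor of \<open>(V, C)\<close>.\<close>

inductive minor :: "'a set \<Rightarrow> 'a set set \<Rightarrow> 'a set \<Rightarrow> 'a set set \<Rightarrow> bool" for V C where
  refl: "minor V C V C"
| delete: "minor V C (V' - {v}) (vertex_deletion C' v)" if "minor V C V' C'" "v \<in> V'"
| contract: "minor V C (V' - {v}) (contraction C' v)" if "minor V C V' C'" "v \<in> V'"

definition W_simplicial :: "'a set \<Rightarrow> 'a set set \<Rightarrow> 'a \<Rightarrow> bool" where
  "W_simplicial V C v \<longleftrightarrow> v \<in> V \<and>
     (\<forall>F1\<in>C. \<forall>F2\<in>C. F1 \<noteq> F2 \<and> v \<in> F1 \<and> v \<in> F2 \<longrightarrow> (\<exists>F3\<in>C. F3 \<subseteq> (F1 \<union> F2) - {v}))"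

definition W_chordal :: "'a set \<Rightarrow> 'a set set \<Rightarrow> bool" where
  "W_chordal V C \<longleftrightarrow> clutter V C \<and>
     (\<forall>V' C'. minor V C V' C' \<and> V' \<noteq> {} \<longrightarrow> (\<exists>v. W_simplicial V' C' v))"

end

theory Submission
  imports Defs
begin

text \<open>
  Statement and induction are carried out for clutters that need not be uniform: if \<open>C\<close> is
  W-chordal and all its circuits have at least \<open>d \<ge> 1\<close> elements, then the circuits with exactly
  \<open>d\<close> elements form a chordal clutter (\<open>W_chordal_layer_chordal\<close>). This class is closed under
  the operations needed: contracting a vertex lowers the minimal size by at most one, and the
  sets of size \<open>d - 1\<close> in the contraction are exactly the link of \<open>v\<close> in the \<open>d\<close>-layer.

  The induction is on the number of vertices. Take a W-simplicial vertex \<open>v\<close> and let \<open>D\<close> be the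
  \<open>d\<close>-layer of \<open>C\<close>. By induction the link of \<open>v\<close> in \<open>D\<close> (from the contraction) and the deletion
  of \<open>v\<close> from \<open>D\<close> are chordal. If \<open>e\<close> is simplicial in the link, then \<open>e \<union> {v}\<close> is simplicial
  in \<open>D\<close>: a \<open>d\<close>-subset of its closed neighbourhood that contains \<open>v\<close> is a circuit because the
  neighbourhood of \<open>e\<close> is a clique in the link; a \<open>d\<close>-subset \<open>S\<close> avoiding \<open>v\<close> has all its
  \<open>(d - 1)\<close>-subsets in the link, so W-simpliciality applied to \<open>(S - {x}) \<union> {v}\<close> and
  \<open>(S - {y}) \<union> {v}\<close> gives a circuit inside \<open>S\<close>, which is \<open>S\<close> itself because no circuit has
  fewer than \<open>d\<close> elements. Deleting \<open>e \<union> {v}\<close> from \<open>D\<close> deletes \<open>e\<close> from the link and leaves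
  the circuits avoiding \<open>v\<close> alone, so an elimination sequence of the link followed by one of the
  deletion eliminates \<open>D\<close> (\<open>chordal_of_link_and_deletion\<close>). For \<open>d = 1\<close>, where the choice of
  \<open>x \<noteq> y\<close> in \<open>S\<close> is impossible, deleting the empty set removes all circuits at once.
\<close>

section \<open>Layers and links under deletion and contraction\<close>

text \<open>The circuits with exactly \<open>d\<close> elements.\<close>

definition layer :: "nat \<Rightarrow> 'a set set \<Rightarrow> 'a set set" where
  "layer d C = {F \<in> C. card F = d}"

text \<open>
  The link of \<open>v\<close>: the sets \<open>F - {v}\<close> for the circuits \<open>F\<close> containing \<open>v\<close>. Unlike in the
  contraction, circuits avoiding \<open>v\<close> do not contribute.
\<close>

definition vertex_link :: "'a set set \<Rightarrow> 'a \<Rightarrow> 'a set set" where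
  "vertex_link D v = {A. v \<notin> A \<and> insert v A \<in> D}"

lemma minor_trans:
  assumes "minor V1 C1 V2 C2" "minor V C V1 C1"
  shows "minor V C V2 C2"
  using assms by induction (auto intro: minor.intros)

lemma clutter_vertex_deletion:
  "clutter V C \<Longrightarrow> clutter (V - {v}) (vertex_deletion C v)"
  by (auto simp: clutter_def vertex_deletion_def)

lemma clutter_contraction:
  assumes "clutter V C"
  shows "clutter (V - {v}) (contraction C v)"
proof -
  have "F \<subseteq> V - {v}" if "F \<in> contraction C v" for F
    using that assms by (auto simp: contraction_def minimal_sets_def clutter_def)
  moreover have "F = G" if "F \<in> contraction C v" "G \<in> contraction C v" "F \<subseteq> G" for F G
    using that unfolding contraction_def minimal_sets_def by blast
  ultimately show ?thesis
    using assms by (simp add: clutter_def)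
qed

lemma W_chordal_vertex_deletion:
  assumes "W_chordal V C" "v \<in> V"
  shows "W_chordal (V - {v}) (vertex_deletion C v)"
  using assms minor_trans[OF _ minor.delete[OF minor.refl \<open>v \<in> V\<close>]]
  by (auto simp: W_chordal_def clutter_vertex_deletion)

lemma W_chordal_contraction:
  assumes "W_chordal V C" "v \<in> V"
  shows "W_chordal (V - {v}) (contraction C v)"
  using assms minor_trans[OF _ minor.contract[OF minor.refl \<open>v \<in> V\<close>]]
  by (auto simp: W_chordal_def clutter_contraction)

lemma layer_vertex_deletion:
  "layer d (vertex_deletion C v) = vertex_deletion (layer d C) v"
  by (auto simp: layer_def vertex_deletion_def)

lemma contraction_card_ge:
  assumes "\<And>F. F \<in> C \<Longrightarrow> Suc k \<le> card F" "A \<in> contraction C v"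
  shows "k \<le> card A"
proof -
  obtain F where F: "F \<in> C" "A = F - {v}"
    using assms(2) by (auto simp: contraction_def minimal_sets_def)
  have "card F \<le> Suc (card A)"
    unfolding F(2) by (cases "v \<in> F") auto
  with assms(1)[OF F(1)] show ?thesis by simp
qed

text \<open>
  No set \<open>F - {v}\<close> has fewer than \<open>k\<close> elements, so those with exactly \<open>k\<close> elements are
  inclusion-minimal; circuits avoiding \<open>v\<close> have at least \<open>Suc k\<close> elements.
\<close>

lemma layer_contraction:
  assumes fin: "\<And>F. F \<in> C \<Longrightarrow> finite F"
    and size: "\<And>F. F \<in> C \<Longrightarrow> Suc k \<le> card F"
  shows "layer k (contraction C v) = vertex_link (layer (Suc k) C) v"
proof (intro set_eqI iffI)
  fix A assume "A \<in> layer k (contraction C v)"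
  then obtain F where F: "F \<in> C" "A = F - {v}" "card A = k"
    by (auto simp: layer_def contraction_def minimal_sets_def)
  have "v \<in> F"
    using F size[of F] by (cases "v \<in> F") auto
  then show "A \<in> vertex_link (layer (Suc k) C) v"
    using F size[of F] by (auto simp: vertex_link_def layer_def insert_absorb)
next
  fix A assume "A \<in> vertex_link (layer (Suc k) C) v"
  then have A: "v \<notin> A" "insert v A \<in> C" "card (insert v A) = Suc k"
    by (auto simp: vertex_link_def layer_def)
  have finA: "finite A" using fin[OF A(2)] by simp
  have cardA: "card A = k" using A(1,3) finA by simp
  have "\<not> F - {v} \<subset> A" if "F \<in> C" for F
  proof
    assume "F - {v} \<subset> A"
    then have "card (F - {v}) < k"
      using psubset_card_mono[OF finA] cardA by blast
    with size[OF that] fin[OF that] show False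
      by (cases "v \<in> F") auto
  qed
  moreover have "A = insert v A - {v}" using A(1) by simp
  ultimately have "A \<in> contraction C v"
    using A(2) unfolding contraction_def minimal_sets_def by blast
  with cardA show "A \<in> layer k (contraction C v)" by (simp add: layer_def)
qed

section \<open>Chordality from the link and the deletion of a vertex\<close>

lemma chordal_mono_vertices:
  assumes "chordal d V C" "V \<subseteq> W"
  shows "chordal d W C"
  using assms
proof induction
  case empty
  show ?case by (rule chordal.empty)
next
  case (step C e)
  then show ?case
    by (intro chordal.step[of d W C e])
       (auto simp: submaximal_circuit_def simplicial_def clique_def)
qed

text \<open>
  The hypothesis \<open>fill\<close> is the trace of W-simpliciality that survives the elimination steps: it
  mentions circuits containing \<open>v\<close> only in its premise. The elimination steps remove no other
  circuits, so they only make that premise harder to satisfy.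
\<close>

lemma chordal_of_link_and_deletion:
  assumes "chordal k (V - {v}) L"
    and "finite V" "v \<in> V"
    and "L = vertex_link D v"
    and fill: "\<And>S. \<lbrakk>v \<notin> S; card S = Suc k; \<And>T. \<lbrakk>T \<subseteq> S; card T = k\<rbrakk> \<Longrightarrow> T \<in> L\<rbrakk> \<Longrightarrow> S \<in> D"
    and "chordal (Suc k) V (vertex_deletion D v)"
  shows "chordal (Suc k) V D"
  using assms
proof (induction arbitrary: D)
  case empty
  have "v \<notin> F" if "F \<in> D" for F
    using that empty.prems(3) by (auto simp: vertex_link_def insert_absorb dest: mk_disjoint_insert)
  then have "vertex_deletion D v = D" by (auto simp: vertex_deletion_def)
  with empty.prems show ?case by simp
next
  case (step L e)
  note L = step.prems(3)
  let ?e = "insert v e"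
  have e: "e \<subseteq> V - {v}" "card e + 1 = k"
    using step.hyps(1) by (auto simp: submaximal_circuit_def)
  have fin_e: "finite e" using e(1) step.prems(1) finite_subset by blast
  have v_e: "v \<notin> e" using e(1) by blast
  obtain A where A: "A \<in> L" "e \<subset> A"
    using step.hyps(1) by (auto simp: submaximal_circuit_def)
  have "submaximal_circuit (Suc k) V D ?e"
    unfolding submaximal_circuit_def
  proof (intro conjI bexI[of _ "insert v A"])
    show "?e \<subset> insert v A" using A v_e L by (auto simp: vertex_link_def)
    show "insert v A \<in> D" using A L by (simp add: vertex_link_def)
  qed (use e fin_e v_e step.prems(2) in auto)
  moreover have "simplicial (Suc k) V D ?e"
  proof -
    have clq: "clique k (V - {v}) L (closed_nbhd L e)"
      using step.hyps(2) by (simp add: simplicial_def)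
    have sub: "closed_nbhd D ?e \<subseteq> insert v (closed_nbhd L e)"
      using v_e by (auto simp: closed_nbhd_def L vertex_link_def insert_commute)
    have "S \<in> D" if S: "S \<subseteq> closed_nbhd D ?e" "card S = Suc k" for S
    proof (cases "v \<in> S")
      case True
      have "card (S - {v}) = k" using True S(2) by simp
      moreover have "S - {v} \<subseteq> closed_nbhd L e" using S(1) sub by blast
      ultimately have "S - {v} \<in> L" using clq by (simp add: clique_def)
      then show ?thesis using True by (simp add: L vertex_link_def insert_absorb)
    next
      case False
      then have "S \<subseteq> closed_nbhd L e" using S(1) sub by blast
      then show ?thesis
        using False S(2) clq step.prems(4)[of S] by (auto simp: clique_def)
    qed
    moreover have "closed_nbhd D ?e \<subseteq> V"
      using sub clq step.prems(2) by (auto simp: clique_def)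
    ultimately show ?thesis by (simp add: simplicial_def clique_def)
  qed
  moreover have "chordal (Suc k) V (set_deletion D ?e)"
  proof (rule step.IH)
    show "set_deletion L e = vertex_link (set_deletion D ?e) v"
      using v_e by (auto simp: L set_deletion_def vertex_link_def)
    show "S \<in> set_deletion D ?e"
      if "v \<notin> S" "card S = Suc k" "\<And>T. \<lbrakk>T \<subseteq> S; card T = k\<rbrakk> \<Longrightarrow> T \<in> set_deletion L e" for S
      using that step.prems(4)[of S] by (auto simp: set_deletion_def)
    have "vertex_deletion (set_deletion D ?e) v = vertex_deletion D v"
      by (auto simp: set_deletion_def vertex_deletion_def)
    with step.prems(5) show "chordal (Suc k) V (vertex_deletion (set_deletion D ?e) v)"
      by simp
  qed (use step.prems in auto)
  ultimately show ?case by (rule chordal.step)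
qed

lemma chordal_singletons:
  assumes "\<And>F. F \<in> C \<Longrightarrow> F \<subseteq> V \<and> card F = 1"
  shows "chordal 1 V C"
proof (cases "C = {}")
  case True
  then show ?thesis by (simp add: chordal.empty)
next
  case False
  \<comment> \<open>The empty set is a simplicial submaximal circuit contained in every circuit.\<close>
  show ?thesis
  proof (rule chordal.step)
    show "submaximal_circuit 1 V C {}"
      using False assms by (fastforce simp: submaximal_circuit_def)
    show "simplicial 1 V C {}"
      using assms
      by (fastforce simp: simplicial_def clique_def closed_nbhd_def card_1_singleton_iff)
    show "chordal 1 V (set_deletion C {})"
      by (simp add: set_deletion_def chordal.empty)
  qed
qed

section \<open>W-chordal clutters\<close>

lemma W_simplicial_fill:
  assumes W: "W_simplicial V C v"
    and fin: "\<And>F. F \<in> C \<Longrightarrow> finite F"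
    and size: "\<And>F. F \<in> C \<Longrightarrow> Suc k \<le> card F"
    and "k \<ge> 1" and "v \<notin> S" and S: "card S = Suc k"
    and facets: "\<And>T. \<lbrakk>T \<subseteq> S; card T = k\<rbrakk> \<Longrightarrow> T \<in> vertex_link (layer (Suc k) C) v"
  shows "S \<in> layer (Suc k) C"
proof -
  have finS: "finite S" using S by (simp add: card_ge_0_finite)
  obtain x where x: "x \<in> S" using S by fastforce
  have "card (S - {x}) \<noteq> 0" using S x \<open>k \<ge> 1\<close> by simp
  then obtain y where y: "y \<in> S" "y \<noteq> x"
    by (metis Diff_iff all_not_in_conv card.empty singletonI)
  have C: "insert v (S - {z}) \<in> C" if "z \<in> S" for z
    using facets[of "S - {z}"] that S by (auto simp: vertex_link_def layer_def)
  have "insert v (S - {x}) \<noteq> insert v (S - {y})"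
    using x y \<open>v \<notin> S\<close> by (metis Diff_iff insertE insertI1 insertI2 singletonD)
  then obtain F where F: "F \<in> C" "F \<subseteq> (insert v (S - {x}) \<union> insert v (S - {y})) - {v}"
    using W C[OF x] C[OF y(1)] unfolding W_simplicial_def by (metis insertI1)
  then have "F \<subseteq> S" by blast
  moreover have "card S \<le> card F" using size[OF F(1)] S by simp
  ultimately have "F = S" using finS by (simp add: card_seteq)
  with F(1) S show ?thesis by (simp add: layer_def)
qed

theorem W_chordal_layer_chordal:
  assumes "W_chordal V C" and "d \<ge> 1" and "\<And>F. F \<in> C \<Longrightarrow> d \<le> card F"
  shows "chordal d V (layer d C)"
  using assms
proof (induction "card V" arbitrary: V C d rule: less_induct)
  case less
  have V: "finite V" and sub: "\<And>F. F \<in> C \<Longrightarrow> F \<subseteq> V"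
    using less.prems(1) by (auto simp: W_chordal_def clutter_def)
  have fin: "\<And>F. F \<in> C \<Longrightarrow> finite F" using V sub finite_subset by blast
  show ?case
  proof (cases "V = {}")
    case True
    then have "layer d C = {}" using sub less.prems(2) by (fastforce simp: layer_def)
    then show ?thesis by (simp add: chordal.empty)
  next
    case nonempty: False
    show ?thesis
    proof (cases "d = 1")
      case True
      then show ?thesis
        using sub chordal_singletons[of "layer 1 C" V] by (simp add: layer_def)
    next
      case False
      then obtain k where k: "d = Suc k" "k \<ge> 1"
        using less.prems(2) by (cases d) auto
      obtain v where v: "W_simplicial V C v"
        using less.prems(1) nonempty minor.refl unfolding W_chordal_def by blast
      then have vV: "v \<in> V" by (simp add: W_simplicial_def)
      have smaller: "card (V - {v}) < card V" using V vV by (simp add: card_gt_0_iff nonempty)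
      have size: "\<And>F. F \<in> C \<Longrightarrow> Suc k \<le> card F" using less.prems(3) k by simp
      have "chordal k (V - {v}) (layer k (contraction C v))"
        using smaller W_chordal_contraction[OF less.prems(1) vV] k(2)
          contraction_card_ge[OF size] by (rule less.hyps)
      then have link: "chordal k (V - {v}) (vertex_link (layer (Suc k) C) v)"
        by (simp add: layer_contraction fin size)
      have "chordal d (V - {v}) (layer d (vertex_deletion C v))"
        using smaller W_chordal_vertex_deletion[OF less.prems(1) vV] less.prems(2)
        by (rule less.hyps) (simp add: vertex_deletion_def less.prems(3))
      then have "chordal (Suc k) V (vertex_deletion (layer (Suc k) C) v)"
        unfolding k(1) layer_vertex_deletion by (rule chordal_mono_vertices) blast
      with link V vV HOL.refl W_simplicial_fill[OF v fin size k(2)]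
      show ?thesis unfolding k(1) by (rule chordal_of_link_and_deletion)
    qed
  qed
qed

theorem proposition3p8:
  fixes V :: "'a set" and C :: "'a set set" and d :: nat
  assumes "d \<ge> 1"
    and "uniform_clutter d V C"
    and "W_chordal V C"
  shows "chordal_clutter d V C"
proof -
  have card: "\<And>F. F \<in> C \<Longrightarrow> card F = d"
    using assms(2) by (simp add: uniform_clutter_def)
  then have "layer d C = C" by (auto simp: layer_def)
  with W_chordal_layer_chordal[OF assms(3,1)] card have "chordal d V C" by simp
  with assms(2) show ?thesis by (simp add: chordal_clutter_def)
qed

end
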